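(* Let $q$ be a prime power and let $\mathcal{H}_q$ be the Hermitian curve in $\mathbb{P}^2$ over $\mathbb{F}_{q^2}$ given by $Y^qZ+YZ^q=X^{q+1}$. If $d$ is an integer with $q+1 \le d \le q^2-q$, then there exists an absolutely irreducible plane projective curve of degree $d$, defined over $\mathbb{F}_{q^2}$, intersecting $\mathcal{H}_q$ in exactly $d(q+1)$ distinct $\mathbb{F}_{q^2}$-rational points.
   Context: A plane projective curve defined over $\mathbb{F}_{q^2}$ is given by a nonzero homogeneous polynomial in $X,Y,Z$ with coefficients in $\mathbb{F}_{q^2}$; it is absolutely irreducible if this polynomial is irreducible over an algebraic closure of $\mathbb{F}_{q^2}$. *)

theory Defs
  imports
    "HOL-Algebra.Algebraic_Closure_Type"
    "HOL-Computational_Algebra.Computational_Algebra"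
    "HOL-Number_Theory.Prime_Powers"
begin

section \<open>Polynomials in three variables\<close>

text \<open>
  The ring $K[X,Y,Z]$ is realised as $K[Z][Y][X]$: the outermost variable is $X$, then $Y$,
  and $Z$ is the innermost one. HOL-Algebra is in scope, so \<open>Polynomial.coeff\<close> and
  \<open>Factorial_Ring.irreducible\<close> are written with their qualified names.
\<close>

type_synonym 'k poly3 = "'k poly poly poly"

definition var_X :: "'k::comm_ring_1 poly3" where "var_X = [:0, 1:]"
definition var_Y :: "'k::comm_ring_1 poly3" where "var_Y = [:[:0, 1:]:]"
definition var_Z :: "'k::comm_ring_1 poly3" where "var_Z = [:[:[:0, 1:]:]:]"

definition coeff3 :: "'k::comm_ring_1 poly3 \<Rightarrow> nat \<Rightarrow> nat \<Rightarrow> nat \<Rightarrow> 'k" where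
  "coeff3 F i j k = Polynomial.coeff (Polynomial.coeff (Polynomial.coeff F i) j) k"

definition eval3 :: "'k::comm_ring_1 poly3 \<Rightarrow> 'k \<Rightarrow> 'k \<Rightarrow> 'k \<Rightarrow> 'k" where
  "eval3 F x y z = poly (poly (poly F [:[:x:]:]) [:y:]) z"

definition homogeneous3 :: "nat \<Rightarrow> 'k::comm_ring_1 poly3 \<Rightarrow> bool" where
  "homogeneous3 d F \<longleftrightarrow> (\<forall>i j k. coeff3 F i j k \<noteq> 0 \<longrightarrow> i + j + k = d)"

lemma eval3_altdef:
  "eval3 F x y z =
     (\<Sum>i\<le>Polynomial.degree F. \<Sum>j\<le>Polynomial.degree (Polynomial.coeff F i).
        \<Sum>k\<le>Polynomial.degree (Polynomial.coeff (Polynomial.coeff F i) j).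
          coeff3 F i j k * x ^ i * y ^ j * z ^ k)"
  unfolding eval3_def coeff3_def
  by (simp add: poly_altdef[of F] poly_altdef[of "Polynomial.coeff F _"]
      poly_altdef[of "Polynomial.coeff (Polynomial.coeff F _) _"]
      poly_sum poly_power sum_distrib_left sum_distrib_right mult_ac)

lemma homogeneous3_eval3_scale:
  assumes "homogeneous3 d F"
  shows "eval3 F (c * x) (c * y) (c * z) = c ^ d * eval3 F x y z"
proof -
  have "coeff3 F i j k * (c * x) ^ i * (c * y) ^ j * (c * z) ^ k =
        c ^ d * (coeff3 F i j k * x ^ i * y ^ j * z ^ k)" for i j k
  proof (cases "coeff3 F i j k = 0")
    case False
    then have "d = i + j + k"
      using assms by (auto simp: homogeneous3_def)
    then show ?thesis
      by (simp add: power_add power_mult_distrib mult_ac)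
  qed simp
  then show ?thesis
    by (simp add: eval3_altdef sum_distrib_left)
qed


section \<open>The projective plane\<close>

definition proj_rel :: "(('k::field \<times> 'k \<times> 'k) \<times> ('k \<times> 'k \<times> 'k)) set" where
  "proj_rel = {((x, y, z), (x', y', z')).
     (x, y, z) \<noteq> (0, 0, 0) \<and> (\<exists>c. c \<noteq> 0 \<and> x' = c * x \<and> y' = c * y \<and> z' = c * z)}"

definition proj_plane :: "('k::field \<times> 'k \<times> 'k) set set" where
  "proj_plane = (UNIV - {(0, 0, 0)}) // proj_rel"

lemma equiv_proj_rel:
  "equiv (UNIV - {(0, 0, 0)}) (proj_rel :: (('k::field \<times> 'k \<times> 'k) \<times> ('k \<times> 'k \<times> 'k)) set)"
proof (rule equivI)
  show "proj_rel \<subseteq> (UNIV - {(0, 0, 0)}) \<times> (UNIV - {(0 :: 'k, 0 :: 'k, 0 :: 'k)})"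
    by (auto simp: proj_rel_def)
  show "refl_on (UNIV - {(0, 0, 0)}) (proj_rel :: (('k \<times> 'k \<times> 'k) \<times> _) set)"
    by (auto simp: refl_on_def proj_rel_def intro!: exI[of _ 1])
  show "sym (proj_rel :: (('k \<times> 'k \<times> 'k) \<times> _) set)"
  proof (rule symI)
    fix u v :: "'k \<times> 'k \<times> 'k"
    assume "(u, v) \<in> proj_rel"
    then obtain x y z c where "u = (x, y, z)" "v = (c * x, c * y, c * z)" "c \<noteq> 0" "u \<noteq> (0, 0, 0)"
      by (auto simp: proj_rel_def)
    then show "(v, u) \<in> proj_rel"
      by (auto simp: proj_rel_def intro!: exI[of _ "inverse c"])
  qed
  show "trans (proj_rel :: (('k \<times> 'k \<times> 'k) \<times> _) set)"
  proof (rule transI)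
    fix u v w :: "'k \<times> 'k \<times> 'k"
    assume uv: "(u, v) \<in> proj_rel" and vw: "(v, w) \<in> proj_rel"
    from uv obtain x y z c where 1: "u = (x, y, z)" "v = (c * x, c * y, c * z)" "c \<noteq> 0" "u \<noteq> (0, 0, 0)"
      by (auto simp: proj_rel_def)
    from vw obtain b where 2: "w = (b * (c * x), b * (c * y), b * (c * z))" "b \<noteq> 0"
      unfolding proj_rel_def 1(2) by blast
    from 1 2 show "(u, w) \<in> proj_rel"
      by (auto simp: proj_rel_def intro!: exI[of _ "b * c"])
  qed
qed


section \<open>Plane projective curves\<close>

definition plane_curve :: "nat \<Rightarrow> 'k::comm_ring_1 poly3 \<Rightarrow> bool" where
  "plane_curve d F \<longleftrightarrow> F \<noteq> 0 \<and> homogeneous3 d F"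

definition base_change :: "'k::field poly3 \<Rightarrow> 'k alg_closure poly3" where
  "base_change = map_poly (map_poly (map_poly to_ac))"

definition absolutely_irreducible :: "'k::field poly3 \<Rightarrow> bool" where
  "absolutely_irreducible F \<longleftrightarrow> Factorial_Ring.irreducible (base_change F)"

text \<open>
  The points of a curve are its geometric points, with coordinates in the algebraic closure.
  For homogeneous \<open>F\<close> the vanishing does not depend on the representative
  (\<open>homogeneous3_eval3_scale\<close>).
\<close>

definition curve_points ::
    "'k::field poly3 \<Rightarrow> ('k alg_closure \<times> 'k alg_closure \<times> 'k alg_closure) set set" where
  "curve_points F =
     {P \<in> proj_plane. \<forall>(x, y, z) \<in> P. eval3 (base_change F) x y z = 0}"

definition rational_points ::
    "('k::field alg_closure \<times> 'k alg_closure \<times> 'k alg_closure) set set" where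
  "rational_points = {P \<in> proj_plane. \<exists>x y z :: 'k. (to_ac x, to_ac y, to_ac z) \<in> P}"

definition hermitian_curve :: "nat \<Rightarrow> 'k::field poly3" where
  "hermitian_curve q = var_Y ^ q * var_Z + var_Y * var_Z ^ q - var_X ^ (q + 1)"

lemma eval3_hermitian_curve:
  "eval3 (hermitian_curve q) x y z = y ^ q * z + y * z ^ q - x ^ (q + 1)"
  by (simp add: eval3_def hermitian_curve_def var_X_def var_Y_def var_Z_def poly_power)

end

theory Submission
  imports Defs "HOL-Number_Theory.Residues"
begin

text \<open>
  If \<open>b\<^sup>q + b \<noteq> 0\<close>, the line \<open>Y = bZ\<close> meets the Hermitian curve \<open>H\<close> in \<open>q + 1\<close> distinct rational
  points. There are at least \<open>q\<^sup>2 - q\<close> such \<open>b\<close>, so a product \<open>G\<close> of \<open>d\<close> such lines has the required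
  intersection, and adding a multiple of \<open>H\<close> does not change it. Take \<open>F = G + c Z\<^sup>k H\<close> with
  \<open>k = d - q - 1\<close> and \<open>c \<noteq> 0\<close>.

  As a polynomial in \<open>X\<close>, \<open>F\<close> has only a leading and a constant term, so by Eisenstein's criterion
  at \<open>Y - rZ\<close> it is irreducible as soon as \<open>r\<close> is a simple root of \<open>h = g + c T\<close>, where
  \<open>T = y\<^sup>q + y\<close> and \<open>g\<close> is \<open>G\<close> at \<open>Z = 1\<close>. A multiple root of \<open>h\<close> is a root of \<open>W = g' T - g T'\<close> and
  determines \<open>c = - g / T\<close>; since \<open>W\<close> has degree less than \<open>q\<^sup>2 - 1\<close>, some \<open>c \<noteq> 0\<close> yields a simple root.
  For \<open>d = q\<^sup>2 - q\<close> the degree bound uses that the characteristic divides \<open>d\<close>.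
\<close>

section \<open>Polynomials\<close>

lemma map_poly_hom_add:
  assumes "f 0 = 0" "\<And>x y. f (x + y) = f x + f y"
  shows "map_poly f (p + r) = map_poly f p + map_poly f r"
  using assms by (intro poly_eqI) (simp add: coeff_map_poly)

lemma map_poly_hom_mult:
  fixes f :: "'a::comm_ring_1 \<Rightarrow> 'b::comm_ring_1"
  assumes "f 0 = 0" "\<And>x y. f (x + y) = f x + f y" "\<And>x y. f (x * y) = f x * f y"
  shows "map_poly f (p * r) = map_poly f p * map_poly f r"
proof -
  have "f (sum g A) = (\<Sum>x\<in>A. f (g x))" for g :: "nat \<Rightarrow> 'a" and A
    by (induction A rule: infinite_finite_induct) (auto simp: assms)
  then show ?thesis
    by (intro poly_eqI) (simp add: coeff_map_poly coeff_mult assms)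
qed

section \<open>Irreducibility and simple roots\<close>

lemma prime_elem_monic_linear:
  fixes a :: "'a::idom"
  shows "prime_elem [:- a, 1:]"
proof (rule prime_elemI)
  show "\<not> [:- a, 1:] dvd 1"
    by (simp add: poly_eq_0_iff_dvd[symmetric])
qed (auto simp: poly_eq_0_iff_dvd[symmetric])

text \<open>The assumption \<open>prim\<close> takes the place of Gauss's lemma: Eisenstein's
  argument shows that one factor is constant, and \<open>prim\<close> makes that constant a unit.
  This works over any integral domain.\<close>

lemma Eisenstein_criterion:
  fixes F :: "'a::idom poly"
  assumes p: "prime_elem p"
    and deg: "Polynomial.degree F > 0"
    and low: "\<And>i. i < Polynomial.degree F \<Longrightarrow> p dvd Polynomial.coeff F i"
    and lead: "\<not> p dvd Polynomial.lead_coeff F"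
    and const: "\<not> p ^ 2 dvd Polynomial.coeff F 0"
    and prim: "\<And>u. [:u:] dvd F \<Longrightarrow> u dvd 1"
  shows "Factorial_Ring.irreducible F"
proof -
  \<comment> \<open>As \<open>p ^ 2\<close> does not divide the constant term, \<open>p\<close> does
    not divide that of \<open>B\<close>. At the least index \<open>i\<close> where \<open>p\<close>
    does not divide the coefficient of \<open>A\<close>, it does not divide that of \<open>F\<close>
    either. So \<open>i\<close> is the degree of \<open>F\<close>, and \<open>B\<close> is
    constant.\<close>
  have unit: "B dvd 1" if F: "F = A * B" and A0: "p dvd Polynomial.coeff A 0" for A B
  proof -
    have nz: "A \<noteq> 0" "B \<noteq> 0" using F deg by auto
    have B0: "\<not> p dvd Polynomial.coeff B 0"
      using const A0 unfolding F by (auto simp: coeff_mult power2_eq_square intro: mult_dvd_mono)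
    have "\<not> p dvd Polynomial.lead_coeff A"
      using lead unfolding F by (auto simp: Polynomial.lead_coeff_mult)
    then obtain i where i: "\<not> p dvd Polynomial.coeff A i"
        "\<And>j. j < i \<Longrightarrow> p dvd Polynomial.coeff A j"
      using exists_least_iff[of "\<lambda>i. \<not> p dvd Polynomial.coeff A i"] by blast
    have "Polynomial.coeff F i =
        (\<Sum>j<i. Polynomial.coeff A j * Polynomial.coeff B (i - j)) +
        Polynomial.coeff A i * Polynomial.coeff B 0"
      unfolding F coeff_mult by (simp add: lessThan_Suc_atMost[symmetric])
    moreover have "p dvd (\<Sum>j<i. Polynomial.coeff A j * Polynomial.coeff B (i - j))"
      using i(2) by (intro dvd_sum) auto
    moreover have "\<not> p dvd Polynomial.coeff A i * Polynomial.coeff B 0"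
      using i(1) B0 p by (simp add: prime_elem_dvd_mult_iff)
    ultimately have "\<not> p dvd Polynomial.coeff F i"
      by (simp add: dvd_add_right_iff)
    then have "i \<ge> Polynomial.degree F" using low[of i] by force
    moreover have "i \<le> Polynomial.degree A" using i(1) by (metis dvd_0_right le_degree)
    moreover have "Polynomial.degree F = Polynomial.degree A + Polynomial.degree B"
      unfolding F using nz by (rule degree_mult_eq)
    ultimately have "Polynomial.degree B = 0" by simp
    then obtain u where u: "B = [:u:]" by (auto elim: degree_eq_zeroE)
    then have "u dvd 1" using prim F by (metis dvd_triv_right)
    then show ?thesis using u by (simp add: is_unit_const_poly_iff)
  qed
  show ?thesis
  proof (rule irreducibleI)
    show "F \<noteq> 0" using deg by auto
    show "\<not> F dvd 1" using deg by (auto simp: is_unit_poly_iff)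
    fix A B assume F: "F = A * B"
    have "p dvd Polynomial.coeff A 0 * Polynomial.coeff B 0"
      using low[of 0] deg by (simp add: F coeff_mult)
    then show "A dvd 1 \<or> B dvd 1"
      using unit[of A B] unit[of B A] p F by (auto simp: prime_elem_dvd_mult_iff mult.commute)
  qed
qed

text \<open>\<open>?W\<close> is the numerator of the derivative of \<open>g / T\<close>. A root of
  \<open>g + smult c T\<close> is a point where \<open>g / T\<close> takes the value
  \<open>- c\<close>, so roots for different \<open>c\<close> differ. If all were multiple,
  \<open>?W\<close> would have at least \<open>card C\<close> roots.\<close>

lemma pencil_simple_root:
  fixes g T :: "'a::alg_closed_field poly"
  assumes coprime: "\<And>x. poly g x = 0 \<Longrightarrow> poly T x \<noteq> 0"
    and deg: "Polynomial.degree T < Polynomial.degree g"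
    and W0: "pderiv g * T - g * pderiv T \<noteq> 0"
    and degW: "Polynomial.degree (pderiv g * T - g * pderiv T) < card C"
  shows "\<exists>c\<in>C. \<exists>r. poly (g + smult c T) r = 0 \<and> poly (pderiv (g + smult c T)) r \<noteq> 0"
proof (rule ccontr)
  let ?W = "pderiv g * T - g * pderiv T"
  assume no: "\<not> ?thesis"
  have "\<exists>r. poly (g + smult c T) r = 0" for c
  proof (rule alg_closed_imp_poly_has_root)
    have "Polynomial.degree (smult c T) < Polynomial.degree g"
      using deg degree_smult_le[of c T] by simp
    then show "0 < Polynomial.degree (g + smult c T)"
      by (simp add: degree_add_eq_left)
  qed
  then obtain r where r: "\<And>c. poly (g + smult c T) (r c) = 0" by metis
  have g: "poly g (r c) = - c * poly T (r c)" for c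
    using r[of c] by (simp add: add_eq_0_iff2)
  have T: "poly T (r c) \<noteq> 0" for c
    using coprime[of "r c"] g[of c] by auto
  have "inj_on r C"
  proof (rule inj_onI)
    fix c c' assume "r c = r c'"
    then have "- c * poly T (r c) = - c' * poly T (r c)" by (metis g)
    then show "c = c'" using T[of c] by simp
  qed
  moreover have "r ` C \<subseteq> {x. poly ?W x = 0}"
  proof safe
    fix c assume "c \<in> C"
    then have "poly (pderiv (g + smult c T)) (r c) = 0" using no r by blast
    then have "poly (pderiv g) (r c) = - c * poly (pderiv T) (r c)"
      by (simp add: pderiv_add pderiv_smult add_eq_0_iff2)
    then show "poly ?W (r c) = 0" by (simp add: g)
  qed
  ultimately have "card C \<le> card {x. poly ?W x = 0}"
    using W0 by (metis card_inj_on_le poly_roots_finite)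
  also have "\<dots> \<le> Polynomial.degree ?W" using W0 by (rule card_poly_roots_bound)
  finally show False using degW by simp
qed

section \<open>The field with \<open>q\<^sup>2\<close> elements\<close>

lemma finite_power_card_eq_same:
  fixes x :: "'a::{field,finite}"
  shows "x ^ card (UNIV :: 'a set) = x"
proof (cases "x = 0")
  case False
  have "(\<Prod>y\<in>UNIV-{0}. x * y) = (\<Prod>y\<in>UNIV-{0}. y)"
    by (rule prod.reindex_bij_witness[of _ "\<lambda>y. y / x" "\<lambda>y. x * y"]) (use False in auto)
  then have "x ^ card (UNIV - {0 :: 'a}) = 1"
    by (simp add: prod.distrib)
  then have "x ^ Suc (card (UNIV - {0 :: 'a})) = x" by simp
  then show ?thesis
    using card_Suc_Diff1[of UNIV "0::'a"] by (simp del: power_Suc)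
qed (simp add: finite_UNIV_card_ge_0)

lemma card_power_eq_one:
  assumes "card (UNIV :: 'a::{field,finite} set) = q ^ 2" "x \<noteq> (0 :: 'a)"
  shows "x ^ (q\<^sup>2 - 1) = 1"
proof -
  have "q > 0" using assms(1) finite_UNIV_card_ge_0[where 'a = 'a] by (cases q) auto
  then have "x * x ^ (q\<^sup>2 - 1) = x"
    using finite_power_card_eq_same[of x] by (simp add: assms(1) flip: power_Suc)
  then show ?thesis using assms(2) by simp
qed

text \<open>The characteristic divides \<open>q ^ 2\<close>, so it is the prime underlying
  \<open>q\<close>. Hence \<open>x ^ q\<close> is an iterate of the Frobenius map and is additive in
  \<open>x\<close>.\<close>

lemma char_square_order:
  assumes "primepow q" "card (UNIV :: 'a::{field,finite} set) = q ^ 2"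
  shows "prime CHAR('a)" "\<exists>n>0. q = CHAR('a) ^ n"
proof -
  have "CHAR('a) > 0" using finite_imp_CHAR_pos[where 'a = 'a] by simp
  then show pr: "prime CHAR('a)" by (rule prime_CHAR_semidom)
  obtain p k where pk: "prime p" "k > 0" "q = p ^ k"
    using assms(1) by (auto simp: primepow_def)
  have "CHAR('a) dvd q ^ 2" using CHAR_dvd_CARD[where 'a = 'a] assms(2) by simp
  then have "CHAR('a) dvd p" using pr unfolding pk by (metis prime_dvd_power)
  then have "CHAR('a) = p" using pk(1) pr by (metis primes_dvd_imp_eq)
  then show "\<exists>n>0. q = CHAR('a) ^ n" using pk by auto
qed

text \<open>\<open>b ^ q + b\<close> is the trace of \<open>b\<close> to the subfield of order
  \<open>q\<close>: the additive map \<open>x ^ q\<close> is an involution and swaps the two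
  summands.\<close>

lemma trace_fixed:
  fixes b :: "'a::{field,finite}"
  assumes "primepow q" "card (UNIV :: 'a set) = q ^ 2"
  shows "(b ^ q + b) ^ q = b ^ q + b"
proof -
  obtain n where "q = CHAR('a) ^ n" using char_square_order[OF assms] by blast
  then have "(b ^ q + b) ^ q = (b ^ q) ^ q + b ^ q"
    using char_square_order(1)[OF assms] by (intro freshmans_dream')
  also have "(b ^ q) ^ q = b"
    using finite_power_card_eq_same[of b] by (simp add: assms power2_eq_square power_mult)
  finally show ?thesis by (simp add: add.commute)
qed

section \<open>Fibres of the norm map\<close>

lemma card_power_eq_le:
  fixes t :: "'a::field"
  assumes "n > 0"
  shows "finite {x. x ^ n = t}" "card {x. x ^ n = t} \<le> n"
proof -
  let ?p = "Polynomial.monom 1 n + [:- t:]"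
  have deg: "Polynomial.degree ?p = n"
    using assms by (simp add: degree_add_eq_left Polynomial.degree_monom_eq)
  then have "?p \<noteq> 0" using assms by auto
  moreover have "{x. x ^ n = t} = {x. poly ?p x = 0}" by (simp add: poly_monom)
  ultimately show "finite {x. x ^ n = t}" "card {x. x ^ n = t} \<le> n"
    using poly_roots_finite[of ?p] card_poly_roots_bound[of ?p] deg by simp_all
qed

text \<open>For \<open>t \<noteq> 0\<close> in the subfield of order \<open>q\<close>, the polynomial \<open>x\<^sup>q\<^sup>+\<^sup>1 - t\<close> divides
  \<open>x\<^sup>m - 1\<close> with \<open>m = q\<^sup>2 - 1\<close>, which splits into distinct linear factors.\<close>
lemma card_norm_fibre:
  fixes t :: "'a::{field,finite}"
  assumes q: "q > 1" and card: "card (UNIV :: 'a set) = q ^ 2" and t: "t \<noteq> 0" "t ^ q = t"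
  shows "card {x. x ^ (q + 1) = t} = q + 1"
proof (rule antisym)
  show "card {x. x ^ (q + 1) = t} \<le> q + 1" by (rule card_power_eq_le) simp
  let ?u = "Polynomial.monom 1 (q + 1) :: 'a poly"
  \<comment> \<open>The cofactor of \<open>x ^ (q + 1) - t\<close> in
    \<open>x ^ ((q + 1) * (q - 1)) - t ^ (q - 1)\<close>, where the exponent is
    \<open>q ^ 2 - 1\<close> and the constant is 1.\<close>
  let ?Q = "\<Sum>i<q - 1. [:t:] ^ (q - 1 - Suc i) * ?u ^ i"
  have fac: "?u ^ (q - 1) - [:t:] ^ (q - 1) = (?u - [:t:]) * ?Q"
    by (rule power_diff_sumr2)
  have "t * t ^ (q - 1) = t" using t(2) q by (simp flip: power_Suc)
  then have t1: "t ^ (q - 1) = 1" using t(1) by simp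
  have q2: "(q + 1) * (q - 1) = q\<^sup>2 - 1"
    by (simp add: power2_eq_square algebra_simps)
  have one: "x ^ (q + 1) = t \<or> poly ?Q x = 0" if "x \<noteq> 0" for x
  proof -
    have "(x ^ (q + 1)) ^ (q - 1) = 1"
      using card_power_eq_one[OF card that] q2 by (metis power_mult)
    moreover have "poly (?u ^ (q - 1) - [:t:] ^ (q - 1)) x = (x ^ (q + 1)) ^ (q - 1) - t ^ (q - 1)"
      by (simp add: poly_monom)
    ultimately have "poly (?u ^ (q - 1) - [:t:] ^ (q - 1)) x = 0"
      by (simp only: t1 diff_self)
    then show ?thesis unfolding fac by (auto simp: poly_monom)
  qed
  have "?u ^ (q - 1) \<noteq> [:t:] ^ (q - 1)"
  proof
    assume "?u ^ (q - 1) = [:t:] ^ (q - 1)"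
    then have "poly (?u ^ (q - 1)) 0 = poly ([:t:] ^ (q - 1)) 0" by simp
    then show False using q t1 by (simp add: poly_monom power_0_left)
  qed
  then have Q0: "?Q \<noteq> 0" using fac by auto
  have degQ: "Polynomial.degree ?Q \<le> (q + 1) * (q - 2)"
  proof (rule degree_sum_le, simp)
    fix i assume "i \<in> {..<q - 1}"
    then have "i \<le> q - 2" by auto
    have "Polynomial.degree ([:t:] ^ (q - 1 - Suc i) * ?u ^ i) \<le> 0 + (q + 1) * i"
      using degree_power_le[of "[:t:]" "q - 1 - Suc i"] degree_power_le[of ?u i]
        degree_mult_le[of "[:t:] ^ (q - 1 - Suc i)" "?u ^ i"]
      by (simp add: Polynomial.degree_monom_eq)
    also have "\<dots> \<le> (q + 1) * (q - 2)" using \<open>i \<le> q - 2\<close> by (simp only: add_0 mult_le_mono2)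
    finally show "Polynomial.degree ([:t:] ^ (q - 1 - Suc i) * ?u ^ i) \<le> (q + 1) * (q - 2)" .
  qed
  \<comment> \<open>All \<open>q ^ 2 - 1\<close> nonzero elements lie in the fibre or are roots of
    \<open>?Q\<close>. The latter number at most \<open>(q + 1) * (q - 2)\<close>, which leaves at
    least \<open>q + 1\<close> for the fibre.\<close>
  have "UNIV - {0} \<subseteq> {x. x ^ (q + 1) = t} \<union> {x. poly ?Q x = 0}"
    using one by auto
  then have "card (UNIV - {0 :: 'a}) \<le> card ({x. x ^ (q + 1) = t} \<union> {x. poly ?Q x = 0})"
    by (intro card_mono) auto
  also have "\<dots> \<le> card {x. x ^ (q + 1) = t} + card {x. poly ?Q x = 0}" by (rule card_Un_le)
  also have "card {x. poly ?Q x = 0} \<le> (q + 1) * (q - 2)"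
    using card_poly_roots_bound[OF Q0] degQ by linarith
  finally have le: "q\<^sup>2 - 1 \<le> card {x. x ^ (q + 1) = t} + (q + 1) * (q - 2)"
    by (simp add: card)
  obtain m where "q = m + 2" using q by (intro that[of "q - 2"]) simp
  with le show "q + 1 \<le> card {x. x ^ (q + 1) = t}"
    by (simp add: power2_eq_square algebra_simps)
qed

text \<open>The degree allows at most \<open>q + 1\<close> solutions in the algebraic closure, and
  the base field already supplies that many. This is why all intersection points are
  rational.\<close>

lemma alg_closure_norm_fibre:
  fixes t :: "'a::{field,finite}"
  assumes q: "q > 1" and card: "card (UNIV :: 'a set) = q ^ 2" and t: "t \<noteq> 0" "t ^ q = t"
  shows "{x. x ^ (q + 1) = to_ac t} = to_ac ` {x. x ^ (q + 1) = t}"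
proof (rule card_seteq[symmetric])
  show "finite {x. x ^ (q + 1) = to_ac t}" by (rule card_power_eq_le) simp
  show "to_ac ` {x. x ^ (q + 1) = t} \<subseteq> {x. x ^ (q + 1) = to_ac t}"
    by (auto simp del: power_Suc simp flip: to_ac_power)
  have "card {x. x ^ (q + 1) = to_ac t} \<le> q + 1" by (rule card_power_eq_le) simp
  also have "\<dots> = card (to_ac ` {x. x ^ (q + 1) = t})"
    using card_norm_fibre[OF assms] by (simp add: card_image inj_on_def)
  finally show "card {x. x ^ (q + 1) = to_ac t} \<le> card (to_ac ` {x. x ^ (q + 1) = t})" .
qed

section \<open>Polynomials in three variables\<close>

definition cst :: "'k::comm_ring_1 \<Rightarrow> 'k poly3" where "cst c = [:[:[:c:]:]:]"

lemma
  shows base_change_add: "base_change (F + G) = base_change F + base_change G"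
    and base_change_mult: "base_change (F * G) = base_change F * base_change G"
proof -
  \<comment> \<open>The embedding is lifted one variable at a time: \<open>?f\<close> acts on
    polynomials in Z, \<open>?g\<close> adds Y, and \<open>base_change\<close> adds X.\<close>
  let ?f = "map_poly to_ac :: 'a poly \<Rightarrow> 'a alg_closure poly"
  have 1: "?f 0 = 0" "?f (p + r) = ?f p + ?f r" "?f (p * r) = ?f p * ?f r" for p r
    by (auto intro!: map_poly_hom_add map_poly_hom_mult)
  let ?g = "map_poly ?f"
  have 2: "?g 0 = 0" "?g (p + r) = ?g p + ?g r" "?g (p * r) = ?g p * ?g r" for p r
    using 1 by (auto intro!: map_poly_hom_add map_poly_hom_mult)
  show "base_change (F + G) = base_change F + base_change G"
    and "base_change (F * G) = base_change F * base_change G"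
    unfolding base_change_def using 2 by (auto intro!: map_poly_hom_add map_poly_hom_mult)
qed

lemma base_change_diff: "base_change (F - G) = base_change F - base_change G"
  using base_change_add[of "F - G" G] by simp

lemma base_change_0 [simp]: "base_change 0 = 0"
  by (simp add: base_change_def)

lemma base_change_1 [simp]: "base_change 1 = 1"
  by (simp add: base_change_def)

lemma base_change_cst: "base_change (cst c) = cst (to_ac c)"
  by (simp add: base_change_def cst_def map_poly_pCons)

lemma base_change_vars:
  "base_change var_X = var_X" "base_change var_Y = var_Y" "base_change var_Z = var_Z"
  by (simp_all add: base_change_def var_X_def var_Y_def var_Z_def map_poly_pCons)

lemma base_change_power: "base_change (F ^ n) = base_change F ^ n"
  by (induction n) (simp_all add: base_change_mult)

lemma base_change_prod: "base_change (\<Prod>x\<in>A. F x) = (\<Prod>x\<in>A. base_change (F x))"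
  by (induction A rule: infinite_finite_induct) (simp_all add: base_change_mult)

lemma base_change_hermitian: "base_change (hermitian_curve q) = hermitian_curve q"
  unfolding hermitian_curve_def
  by (simp only: base_change_add base_change_diff base_change_mult base_change_power base_change_vars)

section \<open>Homogeneity\<close>

lemma homogeneous3_add:
  assumes "homogeneous3 d F" "homogeneous3 d G"
  shows "homogeneous3 d (F + G)"
  using assms unfolding homogeneous3_def coeff3_def by (metis add.right_neutral coeff_add)

lemma homogeneous3_diff:
  assumes "homogeneous3 d F" "homogeneous3 d G"
  shows "homogeneous3 d (F - G)"
  using assms unfolding homogeneous3_def coeff3_def by (metis diff_0_right coeff_diff)

lemma homogeneous3_mult:
  assumes "homogeneous3 d F" "homogeneous3 e G"
  shows "homogeneous3 (d + e) (F * G)"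
  unfolding homogeneous3_def
proof (intro allI impI)
  fix i j k
  assume nz: "coeff3 (F * G) i j k \<noteq> 0"
  have "coeff3 (F * G) i j k = (\<Sum>i'\<le>i. \<Sum>j'\<le>j. \<Sum>k'\<le>k.
      coeff3 F i' j' k' * coeff3 G (i - i') (j - j') (k - k'))"
    by (simp add: coeff3_def coeff_mult Polynomial.coeff_sum)
  then obtain i' j' k' where "i' \<le> i" "j' \<le> j" "k' \<le> k"
      "coeff3 F i' j' k' * coeff3 G (i - i') (j - j') (k - k') \<noteq> 0"
    using nz by (metis (no_types, lifting) sum.not_neutral_contains_not_neutral atMost_iff)
  then have "i' + j' + k' = d" "(i - i') + (j - j') + (k - k') = e"
    using assms unfolding homogeneous3_def by (metis mult_zero_left, metis mult_zero_right)
  then show "i + j + k = d + e" using \<open>i' \<le> i\<close> \<open>j' \<le> j\<close> \<open>k' \<le> k\<close> by linarith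
qed

lemma homogeneous3_cst: "homogeneous3 0 (cst c)"
  by (auto simp: homogeneous3_def coeff3_def cst_def coeff_pCons split: nat.splits)

lemma homogeneous3_vars: "homogeneous3 1 var_X" "homogeneous3 1 var_Y" "homogeneous3 1 var_Z"
  by (auto simp: homogeneous3_def coeff3_def var_X_def var_Y_def var_Z_def coeff_pCons
      split: nat.splits if_splits)

lemma homogeneous3_power: "homogeneous3 d F \<Longrightarrow> homogeneous3 (n * d) (F ^ n)"
proof (induction n)
  case 0
  then show ?case using homogeneous3_cst[of 1] by (simp add: cst_def one_pCons)
next
  case (Suc n)
  then show ?case using homogeneous3_mult[of d F "n * d" "F ^ n"] by simp
qed

lemma homogeneous3_prod:
  assumes "finite A" "\<And>x. x \<in> A \<Longrightarrow> homogeneous3 1 (F x)"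
  shows "homogeneous3 (card A) (\<Prod>x\<in>A. F x)"
  using assms
proof (induction A)
  case empty
  then show ?case using homogeneous3_cst[of 1] by (simp add: cst_def one_pCons)
next
  case (insert x A)
  then show ?case using homogeneous3_mult[of 1 "F x" "card A" "\<Prod>x\<in>A. F x"] by simp
qed

lemma homogeneous3_hermitian: "homogeneous3 (q + 1) (hermitian_curve q)"
  using homogeneous3_add[OF homogeneous3_mult[OF homogeneous3_power[OF homogeneous3_vars(2), of q]
        homogeneous3_vars(3)]
      homogeneous3_mult[OF homogeneous3_vars(2) homogeneous3_power[OF homogeneous3_vars(3), of q],
        simplified add.commute[of 1]]]
    homogeneous3_power[OF homogeneous3_vars(1), of "q + 1"]
  unfolding hermitian_curve_def by (intro homogeneous3_diff) simp_all

section \<open>Evaluation\<close>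

lemma
  shows eval3_add: "eval3 (F + G) x y z = eval3 F x y z + eval3 G x y z"
    and eval3_diff: "eval3 (F - G) x y z = eval3 F x y z - eval3 G x y z"
    and eval3_mult: "eval3 (F * G) x y z = eval3 F x y z * eval3 G x y z"
    and eval3_power: "eval3 (F ^ n) x y z = eval3 F x y z ^ n"
    and eval3_cst: "eval3 (cst c) x y z = c"
    and eval3_vars: "eval3 var_X x y z = x" "eval3 var_Y x y z = y" "eval3 var_Z x y z = z"
  by (simp_all add: eval3_def poly_power cst_def var_X_def var_Y_def var_Z_def)

lemma eval3_prod: "eval3 (\<Prod>a\<in>A. F a) x y z = (\<Prod>a\<in>A. eval3 (F a) x y z)"
  by (simp add: eval3_def poly_prod)

section \<open>A pencil generated by the Hermitian curve and a union of lines\<close>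

text \<open>The lines pass through (1:0:0), so their product is free of X. The power of
  \<open>var_Z\<close> raises the Hermitian form to the degree of that product when
  \<open>card S = k + q + 1\<close>.\<close>

definition line_pencil :: "'k::field set \<Rightarrow> 'k \<Rightarrow> nat \<Rightarrow> nat \<Rightarrow> 'k poly3" where
  "line_pencil S c k q =
     (\<Prod>b\<in>S. var_Y - cst b * var_Z) + cst c * var_Z ^ k * hermitian_curve q"

lemma base_change_line_pencil:
  "base_change (line_pencil S c k q) = line_pencil (to_ac ` S) (to_ac c) k q"
  unfolding line_pencil_def
  by (simp add: base_change_add base_change_diff base_change_mult base_change_power base_change_vars
      base_change_prod base_change_cst base_change_hermitian prod.reindex inj_on_def)

lemma homogeneous3_line_pencil:
  assumes "finite S" "card S = k + q + 1"
  shows "homogeneous3 (card S) (line_pencil S c k q)"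
proof -
  have "homogeneous3 1 (var_Y - cst b * var_Z)" for b :: 'a
    using homogeneous3_diff[OF homogeneous3_vars(2)]
      homogeneous3_mult[OF homogeneous3_cst[of b] homogeneous3_vars(3)] by simp
  then have "homogeneous3 (card S) (\<Prod>b\<in>S. var_Y - cst b * var_Z)"
    using assms(1) by (intro homogeneous3_prod)
  moreover have "homogeneous3 (0 + k * 1 + (q + 1)) (cst c * var_Z ^ k * hermitian_curve q)"
    by (intro homogeneous3_mult homogeneous3_cst homogeneous3_power homogeneous3_vars
        homogeneous3_hermitian)
  ultimately show ?thesis
    unfolding line_pencil_def using assms(2) by (intro homogeneous3_add) (simp_all add: add.assoc)
qed

lemma eval3_line_pencil:
  "eval3 (line_pencil S c k q) x y z =
     (\<Prod>b\<in>S. y - b * z) + c * z ^ k * (y ^ q * z + y * z ^ q - x ^ (q + 1))"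
  unfolding line_pencil_def
  by (simp only: eval3_add eval3_diff eval3_mult eval3_power eval3_cst eval3_vars eval3_prod
      eval3_hermitian_curve)

text \<open>The polynomial in \<open>r0\<close> and \<open>r1\<close> is the form at X = 0, Z = 1. A
  simple root \<open>r\<close> of it makes Y - rZ an exact simple factor of the constant term in
  X.\<close>

lemma Eisenstein_line_pencil:
  fixes S :: "'a::field set"
  assumes S: "finite S" "card S = k + q + 1" and q: "q > 1" and c: "c \<noteq> 0"
    and r0: "poly ((\<Prod>b\<in>S. [:- b, 1:]) + smult c (Polynomial.monom 1 q + [:0, 1:])) r = 0"
    and r1: "poly (pderiv ((\<Prod>b\<in>S. [:- b, 1:]) + smult c (Polynomial.monom 1 q + [:0, 1:]))) r \<noteq> 0"
  shows "Factorial_Ring.irreducible (line_pencil S c k q)"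
proof -
  let ?h = "(\<Prod>b\<in>S. [:- b, 1:]) + smult c (Polynomial.monom 1 q + [:0, 1:])"
  \<comment> \<open>The form is \<open>P\<close> minus \<open>Q\<close> times X to the power
    \<open>q + 1\<close>, with \<open>P\<close> and \<open>Q\<close> polynomials in Y over the
    polynomials in Z. The prime \<open>p\<close> is Y - rZ.\<close>
  define Q :: "'a poly poly" where "Q = [:Polynomial.monom c k:]"
  define P :: "'a poly poly" where
    "P = (\<Prod>b\<in>S. [:[:0, - b:], 1:]) + Q * ([:0, 1:] ^ q * [:[:0, 1:]:] + [:0, 1:] * [:[:0, 1:]:] ^ q)"
  define p :: "'a poly poly" where "p = [:- [:0, r:], 1:]"
  have Q0: "Q \<noteq> 0" using c by (simp add: Q_def)
  have const: "[:A:] * [:B:] = [:A * B:]" "[:A:] + [:B:] = [:A + B:]" "[:A:] - [:B:] = [:A - B:]"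
      "[:A:] ^ n = [:A ^ n:]" for A B :: "'b::comm_ring_1" and n
    by (simp_all add: poly_const_pow)
  have prod: "(\<Prod>b\<in>S. [:f b:]) = [:\<Prod>b\<in>S. f b:]" for f :: "'a \<Rightarrow> 'b::comm_ring_1"
    using S(1) by (induction S) (simp_all add: one_pCons)
  have mono: "Polynomial.monom c k = [:c:] * [:0, 1:] ^ k"
    by (simp add: monom_altdef)
  have "line_pencil S c k q = [:P:] - [:Q:] * [:0, 1:] ^ (q + 1)"
  proof -
    have "var_Y - cst b * var_Z = [:[:[:0, - b:], 1:]:]" for b :: 'a
      by (simp add: var_Y_def var_Z_def cst_def)
    then have 1: "(\<Prod>b\<in>S. var_Y - cst b * var_Z) = [:\<Prod>b\<in>S. [:[:0, - b:], 1:]:]"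
      by (simp only: prod)
    have 2: "cst c * var_Z ^ k = [:Q:]"
      unfolding cst_def var_Z_def Q_def mono by (simp only: const)
    show ?thesis
      unfolding line_pencil_def hermitian_curve_def 1 2 P_def var_X_def
      by (simp only: var_Y_def var_Z_def const right_diff_distrib add_diff_eq)
  qed
  also have "\<dots> = [:P:] + Polynomial.monom (- Q) (q + 1)"
    by (simp add: monom_altdef del: power_Suc)
  finally have F: "line_pencil S c k q = [:P:] + Polynomial.monom (- Q) (q + 1)" .
  have deg: "Polynomial.degree (line_pencil S c k q) = q + 1"
    unfolding F using Q0 by (simp add: degree_add_eq_right Polynomial.degree_monom_eq)
  have coeff: "Polynomial.coeff (line_pencil S c k q) i = (if i = 0 then P else if i = q + 1 then - Q else 0)" for i
    unfolding F by (auto simp: coeff_pCons split: nat.splits)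
  \<comment> \<open>\<open>P\<close> is homogeneous of degree \<open>card S\<close>, so substituting
    Y = rZ gives \<open>poly ?h r\<close> times a power of Z.\<close>
  have "poly P [:0, r:] = Polynomial.monom (poly ?h r) (card S)"
  proof -
    have lin: "[:0, a:] = Polynomial.monom a 1" for a :: 'a
      by (simp add: monom_altdef)
    have "(\<Prod>b\<in>S. Polynomial.monom (r - b) 1) = Polynomial.monom (\<Prod>b\<in>S. r - b) (card S)"
      using S(1) by (induction S) (simp_all add: mult_monom one_pCons monom_0)
    then have "poly (\<Prod>b\<in>S. [:[:0, - b:], 1:]) [:0, r:] = Polynomial.monom (\<Prod>b\<in>S. r - b) (card S)"
      by (simp add: poly_prod lin add_monom)
    moreover have "poly (Q * ([:0, 1:] ^ q * [:[:0, 1:]:] + [:0, 1:] * [:[:0, 1:]:] ^ q)) [:0, r:]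
        = Polynomial.monom (c * (r ^ q + r)) (card S)"
      by (simp add: Q_def lin monom_power mult_monom add_monom S(2) add_ac distrib_left)
    ultimately show ?thesis
      by (simp add: P_def add_monom poly_prod poly_monom)
  qed
  then have root: "p dvd P" using r0 poly_eq_0_iff_dvd[of P "[:0, r:]"] by (simp add: p_def)
  have simple: "\<not> p ^ 2 dvd P"
  proof
    assume "p ^ 2 dvd P"
    then obtain R where R: "P = p * p * R" by (auto simp: dvd_def power2_eq_square)
    \<comment> \<open>Setting Z = 1 turns \<open>P\<close> into \<open>?h\<close> and
      \<open>p\<close> into y - r, so a square factor would make \<open>r\<close> a multiple
      root.\<close>
    let ?e = "map_poly (\<lambda>f. poly f 1) :: 'a poly poly \<Rightarrow> 'a poly"
    have hom: "?e (A + B) = ?e A + ?e B" "?e (A * B) = ?e A * ?e B" for A B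
      by (auto intro!: map_poly_hom_add map_poly_hom_mult)
    have pow: "?e (A ^ n) = ?e A ^ n" for A n
      by (induction n) (simp_all add: hom)
    have pr: "?e (\<Prod>b\<in>S. f b) = (\<Prod>b\<in>S. ?e (f b))" for f :: "'a \<Rightarrow> _"
      by (induction S rule: infinite_finite_induct) (simp_all add: hom)
    have atoms: "?e [:Polynomial.monom c k:] = [:c:]" "?e [:0, 1:] = [:0, 1:]" "?e [:[:0, 1:]:] = 1"
        "?e [:[:0, - b:], 1:] = [:- b, 1:]" for b
      by (simp_all add: map_poly_pCons poly_monom)
    have "?e P = ?h"
      by (simp only: P_def Q_def hom pow pr atoms) (simp add: monom_altdef)
    moreover have "?e p = [:- r, 1:]" by (simp add: p_def map_poly_pCons)
    ultimately have "?h = [:- r, 1:] * [:- r, 1:] * ?e R"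
      using R by (simp add: hom)
    then show False using r1 by (simp only: pderiv_mult) simp
  qed
  \<comment> \<open>The product of lines is monic in Y of degree \<open>card S\<close>, which
    exceeds \<open>q\<close>, a bound for the degree in Y of the Hermitian part.\<close>
  have monic: "Polynomial.lead_coeff P = 1"
  proof -
    let ?G = "\<Prod>b\<in>S. [:[:0, - b:], 1:] :: 'a poly poly"
    let ?B = "Q * ([:0, 1:] ^ q * [:[:0, 1:]:] + [:0, 1:] * [:[:0, 1:]:] ^ q)"
    have G: "Polynomial.degree ?G = card S"
      by (simp add: degree_prod_eq_sum_degree)
    moreover have "Polynomial.lead_coeff ?G = 1"
      by (simp only: lead_coeff_prod) simp
    ultimately have lG: "Polynomial.coeff ?G (card S) = 1" by simp
    have "?B = [:Polynomial.monom c k * [:0, 1:]:] * Polynomial.monom 1 q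
        + [:Polynomial.monom c k * [:0, 1:] ^ q:] * Polynomial.monom 1 1"
      by (simp add: Q_def monom_altdef algebra_simps const)
    also have "Polynomial.degree \<dots> \<le> q"
      using q by (intro degree_add_le)
        (auto intro!: order.trans[OF degree_smult_le] simp: Polynomial.degree_monom_eq)
    finally have "Polynomial.degree ?B < Polynomial.degree ?G" using G S(2) by simp
    then show ?thesis
      unfolding P_def using G lG by (simp add: degree_add_eq_left coeff_eq_0)
  qed
  show ?thesis
  proof (rule Eisenstein_criterion)
    show "prime_elem p" unfolding p_def by (rule prime_elem_monic_linear)
    \<comment> \<open>The leading coefficient \<open>- Q\<close> is free of Y, so it stays nonzero
      at Y = rZ.\<close>
    show "\<not> p dvd Polynomial.lead_coeff (line_pencil S c k q)"
      unfolding deg using c poly_eq_0_iff_dvd[of "- Q" "[:0, r:]"] by (simp add: coeff p_def Q_def)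
    show "\<not> p ^ 2 dvd Polynomial.coeff (line_pencil S c k q) 0"
      using simple by (simp add: coeff)
    show "p dvd Polynomial.coeff (line_pencil S c k q) i"
      if "i < Polynomial.degree (line_pencil S c k q)" for i
      using that root by (auto simp: deg coeff)
    \<comment> \<open>A common divisor of \<open>P\<close> and \<open>Q\<close> is free of Y because
      \<open>Q\<close> is, and then divides the leading coefficient 1 of \<open>P\<close>.\<close>
    fix u assume "[:u:] dvd line_pencil S c k q"
    then have u: "u dvd Polynomial.coeff (line_pencil S c k q) i" for i
      by (simp add: const_poly_dvd_iff)
    have "u dvd P" "u dvd Q" using u[of 0] u[of "q + 1"] by (simp_all add: coeff)
    from \<open>u dvd Q\<close> have "Polynomial.degree u = 0"
      using Q0 dvd_imp_degree_le[of u Q] by (simp add: Q_def)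
    then obtain v where v: "u = [:v:]" by (auto elim: degree_eq_zeroE)
    with \<open>u dvd P\<close> have "v dvd Polynomial.lead_coeff P" by (simp add: const_poly_dvd_iff)
    then show "u dvd 1" unfolding monic v by (simp add: is_unit_const_poly_iff)
  qed (use deg in simp)
qed

section \<open>Intersection points\<close>

abbreviation affine_point :: "'k::field \<times> 'k \<Rightarrow> ('k \<times> 'k \<times> 'k) set" where
  "affine_point u \<equiv> proj_rel `` {(fst u, snd u, 1)}"

lemma inj_affine_point: "inj affine_point"
proof (rule injI)
  fix u v :: "'a \<times> 'a"
  assume "affine_point u = affine_point v"
  moreover have "(fst v, snd v, 1) \<in> affine_point v"
    by (auto simp: proj_rel_def intro!: exI[of _ 1])
  ultimately have "(fst v, snd v, 1) \<in> affine_point u" by simp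
  then show "u = v" by (auto simp: proj_rel_def prod_eq_iff)
qed

text \<open>Membership quantifies over all representatives of a point; homogeneity reduces it to a
  single one.\<close>

lemma mem_curve_points_iff:
  assumes "homogeneous3 d F" "(x, y, z) \<noteq> (0, 0, 0)"
  shows "proj_rel `` {(x, y, z)} \<in> curve_points F \<longleftrightarrow> eval3 (base_change F) x y z = 0"
proof -
  have "homogeneous3 d (base_change F)"
    using assms(1) unfolding homogeneous3_def coeff3_def base_change_def
    by (simp add: coeff_map_poly)
  note scale = homogeneous3_eval3_scale[OF this]
  have "proj_rel `` {(x, y, z)} \<in> proj_plane"
    unfolding proj_plane_def using assms(2) by (intro quotientI) simp
  moreover have "(\<forall>(x', y', z')\<in>proj_rel `` {(x, y, z)}. eval3 (base_change F) x' y' z' = 0) \<longleftrightarrow>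
      eval3 (base_change F) x y z = 0"
  proof
    assume *: "\<forall>(x', y', z')\<in>proj_rel `` {(x, y, z)}. eval3 (base_change F) x' y' z' = 0"
    have "(x, y, z) \<in> proj_rel `` {(x, y, z)}"
      using assms(2) by (auto simp: proj_rel_def intro!: exI[of _ 1])
    with * show "eval3 (base_change F) x y z = 0" by blast
  qed (auto simp: proj_rel_def scale)
  ultimately show ?thesis by (simp add: curve_points_def)
qed

text \<open>On the Hermitian curve the pencil vanishes exactly where the product of lines does.
  There Z = 0 would force Y = 0 and X = 0, so every common point is affine. The converse appears
  because the fibres lie over y while \<open>affine_point\<close> takes (x, y).\<close>

lemma line_pencil_inter_hermitian:
  fixes S :: "'a::field set"
  assumes S: "finite S" "card S = k + q + 1" and q: "q > 1"
  shows "curve_points (line_pencil S c k q) \<inter> curve_points (hermitian_curve q) =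
    affine_point ` (SIGMA y:to_ac ` S. {x. x ^ (q + 1) = y ^ q + y})\<inverse>"
proof (intro equalityI subsetI)
  let ?F = "line_pencil S c k q" and ?H = "hermitian_curve q :: 'a poly3"
  have F: "homogeneous3 (card S) ?F" by (rule homogeneous3_line_pencil[OF S])
  note memF = mem_curve_points_iff[OF F, unfolded base_change_line_pencil eval3_line_pencil]
  note memH = mem_curve_points_iff[OF homogeneous3_hermitian, unfolded base_change_hermitian eval3_hermitian_curve]
  {
    fix P assume P: "P \<in> curve_points ?F \<inter> curve_points ?H"
    then obtain x y z where xyz: "P = proj_rel `` {(x, y, z)}" "(x, y, z) \<noteq> (0, 0, 0)"
      by (auto simp: curve_points_def proj_plane_def quotient_def)
    have H: "y ^ q * z + y * z ^ q - x ^ (q + 1) = 0"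
      using P xyz memH[of x y z q] by simp
    have "(\<Prod>b\<in>to_ac ` S. y - b * z) = 0"
      using P xyz memF[of x y z] H by simp
    then obtain b where b: "b \<in> to_ac ` S" "y = b * z" using S(1) by auto
    have z: "z \<noteq> 0"
    proof
      assume "z = 0"
      with b(2) H q have "y = 0" "x = 0" by auto
      with \<open>z = 0\<close> xyz(2) show False by simp
    qed
    have P': "P = affine_point (x / z, b)"
      unfolding xyz(1) using z b(2) xyz(2)
      by (intro equiv_class_eq[OF equiv_proj_rel])
         (auto simp: proj_rel_def intro!: exI[of _ "inverse z"] simp: field_simps)
    have "b ^ q * 1 + b * 1 ^ q - (x / z) ^ (q + 1) = 0"
      using memH[of "x / z" b 1 q] P P' by simp
    then have "(x / z, b) \<in> (SIGMA y:to_ac ` S. {x. x ^ (q + 1) = y ^ q + y})\<inverse>"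
      using b(1) by auto
    with P' show "P \<in> affine_point ` (SIGMA y:to_ac ` S. {x. x ^ (q + 1) = y ^ q + y})\<inverse>"
      by blast
  next
    fix P assume "P \<in> affine_point ` (SIGMA y:to_ac ` S. {x. x ^ (q + 1) = y ^ q + y})\<inverse>"
    then obtain x y where xy: "P = proj_rel `` {(x, y, 1)}" "y \<in> to_ac ` S" "x ^ (q + 1) = y ^ q + y"
      by auto
    have "(\<Prod>b\<in>to_ac ` S. y - b * 1) = 0" using xy(2) S(1) by auto
    then show "P \<in> curve_points ?F \<inter> curve_points ?H"
      unfolding xy(1) Int_iff memF[of x y 1, simplified] memH[of x y 1 q, simplified]
      using xy(3) by simp
  }
qed

text \<open>Each line contributes the norm fibre over the nonzero trace \<open>b ^ q + b\<close>,
  that is, \<open>q + 1\<close> rational points; distinct lines have distinct y-coordinates.\<close>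

lemma hermitian_lines_points:
  fixes S :: "'a::{field,finite} set"
  assumes q: "primepow q" "card (UNIV :: 'a set) = q ^ 2"
    and S: "card S = k + q + 1" "\<And>b. b \<in> S \<Longrightarrow> b ^ q + b \<noteq> 0"
  shows "curve_points (line_pencil S c k q) \<inter> curve_points (hermitian_curve q) \<subseteq> rational_points"
    and "card (curve_points (line_pencil S c k q) \<inter> curve_points (hermitian_curve q)) = card S * (q + 1)"
proof -
  have q1: "q > 1" using q(1) by (rule primepow_gt_Suc_0[unfolded One_nat_def[symmetric]])
  have fib: "{x. x ^ (q + 1) = to_ac b ^ q + to_ac b} = to_ac ` {x. x ^ (q + 1) = b ^ q + b}" if "b \<in> S" for b
    using alg_closure_norm_fibre[OF q1 q(2) S(2)[OF that] trace_fixed[OF q]] by simp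
  have eq: "(SIGMA y:to_ac ` S. {x. x ^ (q + 1) = y ^ q + y})\<inverse>
      = (\<lambda>(b, x). (to_ac x, to_ac b)) ` (SIGMA b:S. {x. x ^ (q + 1) = b ^ q + b})"
  proof -
    have "(SIGMA y:to_ac ` S. {x. x ^ (q + 1) = y ^ q + y})\<inverse> =
        (\<Union>b\<in>S. {x. x ^ (q + 1) = to_ac b ^ q + to_ac b} \<times> {to_ac b})" by auto
    also have "\<dots> = (\<Union>b\<in>S. to_ac ` {x. x ^ (q + 1) = b ^ q + b} \<times> {to_ac b})"
      by (intro SUP_cong refl) (simp only: fib)
    also have "\<dots> = (\<lambda>(b, x). (to_ac x, to_ac b)) ` (SIGMA b:S. {x. x ^ (q + 1) = b ^ q + b})"
      by force
    finally show ?thesis .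
  qed
  have inter: "curve_points (line_pencil S c k q) \<inter> curve_points (hermitian_curve q) =
      affine_point ` (\<lambda>(b, x). (to_ac x, to_ac b)) ` (SIGMA b:S. {x. x ^ (q + 1) = b ^ q + b})"
    using line_pencil_inter_hermitian[OF finite S(1) q1] by (simp only: eq)
  show "curve_points (line_pencil S c k q) \<inter> curve_points (hermitian_curve q) \<subseteq> rational_points"
  proof
    fix P assume P: "P \<in> curve_points (line_pencil S c k q) \<inter> curve_points (hermitian_curve q)"
    then obtain x b :: 'a where xb: "P = proj_rel `` {(to_ac x, to_ac b, 1)}"
      unfolding inter by force
    have "(to_ac x, to_ac b, to_ac 1) \<in> P"
      unfolding xb by (auto simp: proj_rel_def intro!: exI[of _ 1])
    moreover have "P \<in> proj_plane" using P by (simp add: curve_points_def)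
    ultimately show "P \<in> rational_points" unfolding rational_points_def by blast
  qed
  have "card (curve_points (line_pencil S c k q) \<inter> curve_points (hermitian_curve q)) =
      card (SIGMA b:S. {x. x ^ (q + 1) = b ^ q + b})"
  proof -
    let ?A = "SIGMA b:S. {x. x ^ (q + 1) = b ^ q + b}"
    have "inj_on (\<lambda>(b, x). (to_ac x, to_ac b)) ?A" by (auto simp: inj_on_def)
    moreover have "inj_on affine_point A" for A :: "('a alg_closure \<times> 'a alg_closure) set"
      by (rule inj_on_subset[OF inj_affine_point subset_UNIV])
    ultimately show ?thesis
      unfolding inter by (simp only: card_image)
  qed
  also have "\<dots> = (\<Sum>b\<in>S. card {x. x ^ (q + 1) = b ^ q + b})"
    by (rule card_SigmaI) auto
  also have "\<dots> = (\<Sum>b\<in>S. q + 1)"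
    using card_norm_fibre[OF q1 q(2) S(2) trace_fixed[OF q]] by (intro sum.cong) auto
  finally show "card (curve_points (line_pencil S c k q) \<inter> curve_points (hermitian_curve q)) = card S * (q + 1)"
    by simp
qed

section \<open>Choice of the pencil parameter\<close>

lemma exists_irreducible_line_pencil:
  fixes S :: "'a::{field,finite} set"
  assumes q: "primepow q" "card (UNIV :: 'a set) = q ^ 2"
    and S: "card S = k + q + 1" "card S \<le> q ^ 2 - q" "\<And>b. b \<in> S \<Longrightarrow> b ^ q + b \<noteq> 0"
  shows "\<exists>c. absolutely_irreducible (line_pencil S c k q)"
proof -
  have q1: "q > 1" using q(1) by (rule primepow_gt_Suc_0[unfolded One_nat_def[symmetric]])
  \<comment> \<open>For \<open>q = 2\<close> the range \<open>q + 1\<close> to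
    \<open>q ^ 2 - q\<close> is empty.\<close>
  have q3: "q \<ge> 3"
  proof (rule ccontr)
    assume "\<not> q \<ge> 3"
    then have "q = 2" using q1 by simp
    then show False using S(1,2) by simp
  qed
  define T where "T = (Polynomial.monom 1 q + [:0, 1:] :: 'a alg_closure poly)"
  define g where "g = (\<Prod>b\<in>to_ac ` S. [:- b, 1:])"
  \<comment> \<open>Parameters come from the base field so that the curve is defined there, whereas
    the simple root may lie in the algebraic closure.\<close>
  let ?C = "to_ac ` (UNIV - {0 :: 'a})"
  obtain n where n: "n > 0" "q = CHAR('a) ^ n" using char_square_order[OF q] by blast
  have q0: "of_nat q = (0 :: 'a alg_closure)"
    using n to_ac_of_nat[of q, where 'a = 'a] by (simp del: to_ac_of_nat add: zero_power)
  have cS: "card (to_ac ` S) = card S" by (simp add: card_image inj_on_def)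
  have degg: "Polynomial.degree g = card S"
    unfolding g_def by (simp add: degree_prod_eq_sum_degree cS)
  have degT: "Polynomial.degree T = q"
    using q1 unfolding T_def by (subst degree_add_eq_left) (simp_all add: Polynomial.degree_monom_eq)
  have T': "pderiv T = 1" unfolding T_def by (simp add: pderiv_add pderiv_monom q0 pderiv_pCons)
  have cop: "poly T x \<noteq> 0" if "poly g x = 0" for x
  proof -
    have "(\<Prod>b\<in>to_ac ` S. poly [:- b, 1:] x) = 0"
      using that by (simp only: g_def poly_prod)
    then obtain b where "b \<in> S" "x = to_ac b"
      using prod_zero_iff[OF finite_imageI[OF finite[of S]], of "\<lambda>b. poly [:- b, 1:] x" to_ac]
      by auto
    then have "poly T x = to_ac (b ^ q + b)" by (simp add: T_def poly_monom)
    then show ?thesis using S(3)[OF \<open>b \<in> S\<close>] by (simp del: to_ac_add to_ac_power)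
  qed
  have "q\<^sup>2 \<ge> 3 * q" using q3 by (simp add: power2_eq_square)
  then have "card S < q\<^sup>2 - 1" using S(2) q3 by linarith
  have W: "Polynomial.degree (pderiv g * T - g * pderiv T) < q\<^sup>2 - 1"
  proof (rule degree_diff_less)
    \<comment> \<open>The degree of \<open>pderiv g\<close> could exceed
      \<open>q ^ 2 - q - 2\<close> only for \<open>card S = q * (q - 1)\<close>; then its top
      coefficient carries the factor \<open>card S\<close>, which vanishes in characteristic
      dividing \<open>q\<close>.\<close>
    have "Polynomial.coeff (pderiv g) i = 0" if "i > q\<^sup>2 - q - 2" for i
    proof (cases "Suc i = card S")
      case True
      then have "Suc i = q * (q - 1)" using that S(2) \<open>q\<^sup>2 \<ge> 3 * q\<close> q3
        by (simp add: power2_eq_square algebra_simps)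
      then have "of_nat (Suc i) = (0 :: 'a alg_closure)" by (simp only: of_nat_mult q0) simp
      then show ?thesis by (simp add: coeff_pderiv del: of_nat_Suc)
    next
      case False
      then have "Suc i > Polynomial.degree g" using that S(2) by (simp add: degg)
      then show ?thesis by (simp add: coeff_pderiv coeff_eq_0)
    qed
    then have "Polynomial.degree (pderiv g) \<le> q\<^sup>2 - q - 2" by (intro degree_le) auto
    then have "Polynomial.degree (pderiv g * T) \<le> q\<^sup>2 - q - 2 + q"
      using degree_mult_le[of "pderiv g" T] degT by simp
    then show "Polynomial.degree (pderiv g * T) < q\<^sup>2 - 1" using \<open>q\<^sup>2 \<ge> 3 * q\<close> q3 by linarith
    show "Polynomial.degree (g * pderiv T) < q\<^sup>2 - 1" using \<open>card S < q\<^sup>2 - 1\<close> by (simp add: T' degg)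
  qed
  \<comment> \<open>\<open>?W\<close> of the pencil lemma is nonzero because its value at 0 is minus
    that of \<open>g\<close>, and 0 is a root of \<open>T\<close>, hence none of
    \<open>g\<close>.\<close>
  have T0: "poly T 0 = 0" using q1 by (simp add: T_def poly_monom)
  then have "poly g 0 \<noteq> 0" using cop by blast
  then have "poly (pderiv g * T - g * pderiv T) 0 \<noteq> 0" by (simp add: T' T0)
  then have W0: "pderiv g * T - g * pderiv T \<noteq> 0" by (metis poly_0)
  have "card ?C = q\<^sup>2 - 1" by (simp add: card_image inj_on_def q(2))
  then obtain c r where c: "c \<in> ?C" and r: "poly (g + smult c T) r = 0" "poly (pderiv (g + smult c T)) r \<noteq> 0"
    using pencil_simple_root[of g T ?C, OF cop _ W0] W degT degg S(1) by auto
  obtain c' where c': "c = to_ac c'" "c' \<noteq> 0" using c by auto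
  have "Factorial_Ring.irreducible (line_pencil (to_ac ` S) c k q)"
    using r c' q1 S(1) unfolding g_def T_def
    by (intro Eisenstein_line_pencil[where r = r]) (simp_all add: cS)
  then show ?thesis
    unfolding absolutely_irreducible_def base_change_line_pencil c'(1) by blast
qed

theorem theorem2p1:
  fixes q d :: nat
  assumes "primepow q"
    and "card (UNIV :: 'a :: {field, finite} set) = q ^ 2"
    and "q + 1 \<le> d"
    and "d \<le> q ^ 2 - q"
  shows "\<exists>F :: 'a poly3.
    plane_curve d F \<and>
    absolutely_irreducible F \<and>
    curve_points F \<inter> curve_points (hermitian_curve q) \<subseteq> rational_points \<and>
    card (curve_points F \<inter> curve_points (hermitian_curve q)) = d * (q + 1)"
proof -
  have q1: "q > 1" using assms(1) by (rule primepow_gt_Suc_0[unfolded One_nat_def[symmetric]])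
  let ?T = "Polynomial.monom 1 q + [:0, 1:] :: 'a poly"
  have degT: "Polynomial.degree ?T = q"
    using q1 by (subst degree_add_eq_left) (simp_all add: Polynomial.degree_monom_eq)
  then have "?T \<noteq> 0" using q1 by auto
  \<comment> \<open>At most \<open>q\<close> elements have trace 0, so at least
    \<open>q ^ 2 - q\<close> lines are available; this is the upper bound on
    \<open>d\<close>.\<close>
  then have "card {b. poly ?T b = 0} \<le> q" using card_poly_roots_bound degT by metis
  moreover have "card {b. poly ?T b \<noteq> 0} = q\<^sup>2 - card {b. poly ?T b = 0}"
    using card_Diff_subset[of "{b. poly ?T b = 0}" UNIV] by (simp add: set_diff_eq assms(2))
  ultimately have "d \<le> card {b. poly ?T b \<noteq> 0}" using assms(4) by linarith
  then obtain S where S: "S \<subseteq> {b. poly ?T b \<noteq> 0}" "card S = d"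
    by (metis obtain_subset_with_card_n)
  define k where "k = d - (q + 1)"
  have d: "d = k + q + 1" using assms(3) by (simp add: k_def)
  have tr: "b ^ q + b \<noteq> 0" if "b \<in> S" for b
    using that S(1) by (auto simp: poly_monom)
  obtain c where c: "absolutely_irreducible (line_pencil S c k q)"
    using exists_irreducible_line_pencil[OF assms(1,2), of S k] S(2) d assms(4) tr by auto
  have "line_pencil S c k q \<noteq> 0"
    using c by (auto simp: absolutely_irreducible_def)
  moreover have "homogeneous3 d (line_pencil S c k q)"
    using homogeneous3_line_pencil[OF finite[of S], of k q c] S(2) d by simp
  ultimately have "plane_curve d (line_pencil S c k q)" by (simp add: plane_curve_def)
  moreover note hermitian_lines_points[OF assms(1,2), of S k c]
  ultimately show ?thesis using c S(2) d tr by metis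
qed

end
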